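(* Let $G$ be a plane graph whose set of vertices has no accumulation point in $\mathbb{R}^2$ and which has bounded vertex degrees, and suppose $G$ is hyperbolic and weakly non-amenable. If every face of $G$ is contained inside a geodetic cycle, then $G$ has bounded codegree, i.e. $\Delta(G^* )<\infty$.
   Context: A plane graph is a graph with a fixed embedding in $\mathbb{R}^2$ with no two edges crossing. A face is a connected component of $\mathbb{R}^2$ minus the image of the graph; its length $|F|$ is the number of edges in its boundary (the vertices and edges mapped into its closure); it is bounded if its length is finite. $\Delta(G^* ):=\sup\{|F| : F\text{ a bounded face}\}$. A set is inside a cycle $C$ if each of its points lies on $C$ or in the bounded component of $\mathbb{R}^2\setminus C$. For vertices $x,y$ on a cycle $C$, $xCy$ and $yCx$ are the two arcs of $C$ between them; $C$ is a geodetic cycle if for every $x,y\in C$ at least one of $xCy,yCx$ is a geodesic of $G$. For finite $S\subset V(G)$, $\partial S$ is the set of vertices outside $S$ adjacent to a vertex of $S$; $G$ is weakly non-amenable if there is a monotone increasing diverging $f:\mathbb{N}\to\mathbb{N}$ with $|S|\le f(|\partial S|)$ for all non-empty finite $S$. A graph is hyperbolic if there is $\delta\ge0$ such that in each connected component every geodetic triangle (three vertices joined pairwise by geodesics) has each side in the $\delta$-neighbourhood of the union of the other two. *)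

theory Defs
  imports "HOL-Analysis.Analysis" "HOL-Library.Extended_Nat"
begin

text \<open>A (simple) graph is given by a vertex set V and a set E of 2-element vertex sets.
  The plane R^2 is modelled by the type complex.  A plane embedding is given by
  a position map p for vertices and an arc map a for edges.\<close>

definition plane_graph ::
  "'v set \<Rightarrow> 'v set set \<Rightarrow> ('v \<Rightarrow> complex) \<Rightarrow> ('v set \<Rightarrow> real \<Rightarrow> complex) \<Rightarrow> bool" where
  "plane_graph V E p a \<longleftrightarrow>
     (\<forall>e\<in>E. \<exists>u v. e = {u, v} \<and> u \<noteq> v \<and> u \<in> V \<and> v \<in> V) \<and>
     inj_on p V \<and>
     (\<forall>e\<in>E. arc (a e) \<and> {pathstart (a e), pathfinish (a e)} = p ` e) \<and>
     (\<forall>e\<in>E. \<forall>v\<in>V. p v \<in> path_image (a e) \<longrightarrow> v \<in> e) \<and>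
     (\<forall>e\<in>E. \<forall>e'\<in>E. e \<noteq> e' \<longrightarrow> path_image (a e) \<inter> path_image (a e') \<subseteq> p ` (e \<inter> e'))"

definition graph_image ::
  "'v set \<Rightarrow> 'v set set \<Rightarrow> ('v \<Rightarrow> complex) \<Rightarrow> ('v set \<Rightarrow> real \<Rightarrow> complex) \<Rightarrow> complex set" where
  "graph_image V E p a = p ` V \<union> (\<Union>e\<in>E. path_image (a e))"

definition faces ::
  "'v set \<Rightarrow> 'v set set \<Rightarrow> ('v \<Rightarrow> complex) \<Rightarrow> ('v set \<Rightarrow> real \<Rightarrow> complex) \<Rightarrow> complex set set" where
  "faces V E p a = components (- graph_image V E p a)"

definition face_edges ::
  "'v set set \<Rightarrow> ('v set \<Rightarrow> real \<Rightarrow> complex) \<Rightarrow> complex set \<Rightarrow> 'v set set" where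
  "face_edges E a F = {e \<in> E. path_image (a e) \<subseteq> closure F}"

text \<open>Delta(G^*): supremum of the lengths of bounded faces (faces of finite length).\<close>
definition codegree ::
  "'v set \<Rightarrow> 'v set set \<Rightarrow> ('v \<Rightarrow> complex) \<Rightarrow> ('v set \<Rightarrow> real \<Rightarrow> complex) \<Rightarrow> enat" where
  "codegree V E p a =
     (SUP F \<in> {F \<in> faces V E p a. finite (face_edges E a F)}. enat (card (face_edges E a F)))"

definition neighbours :: "'v set set \<Rightarrow> 'v \<Rightarrow> 'v set" where
  "neighbours E v = {u. {v, u} \<in> E}"

definition bounded_degree :: "'v set \<Rightarrow> 'v set set \<Rightarrow> bool" where
  "bounded_degree V E \<longleftrightarrow> (\<exists>d::nat. \<forall>v\<in>V. finite (neighbours E v) \<and> card (neighbours E v) \<le> d)"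

definition gpath :: "'v set \<Rightarrow> 'v set set \<Rightarrow> 'v list \<Rightarrow> bool" where
  "gpath V E xs \<longleftrightarrow> xs \<noteq> [] \<and> distinct xs \<and> set xs \<subseteq> V \<and>
     (\<forall>i. Suc i < length xs \<longrightarrow> {xs ! i, xs ! Suc i} \<in> E)"

definition geodesic :: "'v set \<Rightarrow> 'v set set \<Rightarrow> 'v list \<Rightarrow> bool" where
  "geodesic V E xs \<longleftrightarrow> gpath V E xs \<and>
     (\<forall>ys. gpath V E ys \<and> hd ys = hd xs \<and> last ys = last xs \<longrightarrow> length xs \<le> length ys)"

text \<open>Graph distance (number of edges of a shortest path); only used for connected vertices.\<close>
definition gdist :: "'v set \<Rightarrow> 'v set set \<Rightarrow> 'v \<Rightarrow> 'v \<Rightarrow> nat" where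
  "gdist V E u v = (LEAST n. \<exists>xs. gpath V E xs \<and> hd xs = u \<and> last xs = v \<and> length xs = Suc n)"

definition near_side :: "'v set \<Rightarrow> 'v set set \<Rightarrow> real \<Rightarrow> 'v list \<Rightarrow> 'v list \<Rightarrow> 'v list \<Rightarrow> bool" where
  "near_side V E \<delta> P Q R \<longleftrightarrow>
     (\<forall>w\<in>set P. \<exists>w'\<in>set Q \<union> set R. real (gdist V E w w') \<le> \<delta>)"

text \<open>Hyperbolicity: one delta for all geodetic triangles (which automatically lie in
  a single component).\<close>
definition hyperbolic :: "'v set \<Rightarrow> 'v set set \<Rightarrow> bool" where
  "hyperbolic V E \<longleftrightarrow> (\<exists>\<delta>::real. \<delta> \<ge> 0 \<and>
     (\<forall>P Q R. geodesic V E P \<and> geodesic V E Q \<and> geodesic V E R \<and>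
        last P = hd Q \<and> last Q = hd R \<and> last R = hd P \<longrightarrow>
        near_side V E \<delta> P Q R \<and> near_side V E \<delta> Q R P \<and> near_side V E \<delta> R P Q))"

definition vboundary :: "'v set \<Rightarrow> 'v set set \<Rightarrow> 'v set \<Rightarrow> 'v set" where
  "vboundary V E S = {v \<in> V - S. \<exists>u\<in>S. {u, v} \<in> E}"

definition weakly_nonamenable :: "'v set \<Rightarrow> 'v set set \<Rightarrow> bool" where
  "weakly_nonamenable V E \<longleftrightarrow> (\<exists>f::nat \<Rightarrow> nat. mono f \<and> filterlim f at_top at_top \<and>
     (\<forall>S. S \<subseteq> V \<and> finite S \<and> S \<noteq> {} \<longrightarrow> card S \<le> f (card (vboundary V E S))))"

definition gcycle :: "'v set \<Rightarrow> 'v set set \<Rightarrow> 'v list \<Rightarrow> bool" where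
  "gcycle V E xs \<longleftrightarrow> length xs \<ge> 3 \<and> distinct xs \<and> set xs \<subseteq> V \<and>
     (\<forall>i < length xs. {xs ! i, xs ! (Suc i mod length xs)} \<in> E)"

definition cyc_arc :: "'v list \<Rightarrow> nat \<Rightarrow> nat \<Rightarrow> 'v list" where
  "cyc_arc xs i j = map (\<lambda>k. xs ! ((i + k) mod length xs))
      [0 ..< Suc ((j + length xs - i) mod length xs)]"

definition geodetic_cycle :: "'v set \<Rightarrow> 'v set set \<Rightarrow> 'v list \<Rightarrow> bool" where
  "geodetic_cycle V E xs \<longleftrightarrow> gcycle V E xs \<and>
     (\<forall>i < length xs. \<forall>j < length xs. geodesic V E (cyc_arc xs i j) \<or> geodesic V E (cyc_arc xs j i))"

definition cycle_edges :: "'v list \<Rightarrow> 'v set set" where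
  "cycle_edges xs = {{xs ! i, xs ! (Suc i mod length xs)} | i. i < length xs}"

definition cycle_image :: "('v set \<Rightarrow> real \<Rightarrow> complex) \<Rightarrow> 'v list \<Rightarrow> complex set" where
  "cycle_image a xs = (\<Union>e\<in>cycle_edges xs. path_image (a e))"

definition inside_cycle :: "('v set \<Rightarrow> real \<Rightarrow> complex) \<Rightarrow> 'v list \<Rightarrow> complex set \<Rightarrow> bool" where
  "inside_cycle a xs X \<longleftrightarrow> X \<subseteq> cycle_image a xs \<union> inside (cycle_image a xs)"

end

theory Submission
  imports Defs
begin

text \<open>In a \<open>\<delta>\<close>-hyperbolic graph a geodetic cycle has bounded length: three equidistant vertices
  span a geodetic triangle whose sides are arcs of the cycle, and the midpoint of a side is at
  distance about a sixth of the length from the other two sides. The vertices strictly inside a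
  cycle have their vertex boundary on the cycle, so weak non-amenability bounds their number. All
  edges of a face inside the cycle join vertices on or inside the cycle, hence there are boundedly
  many of them.\<close>

section \<open>Arcs of a cycle as vertex lists\<close>

lemma gpath_rev:
  assumes "gpath V E xs"
  shows "gpath V E (rev xs)"
proof -
  have "{rev xs ! i, rev xs ! Suc i} \<in> E" if "Suc i < length xs" for i
  proof -
    have "{xs ! (length xs - Suc (Suc i)), xs ! Suc (length xs - Suc (Suc i))} \<in> E"
      using assms that by (auto simp: gpath_def)
    moreover have "Suc (length xs - Suc (Suc i)) = length xs - Suc i"
      using that by simp
    ultimately show ?thesis
      using that by (simp add: rev_nth insert_commute)
  qed
  then show ?thesis
    using assms by (simp add: gpath_def)
qed

lemma length_cyc_arc: "length (cyc_arc xs i j) = Suc ((j + length xs - i) mod length xs)"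
  by (simp add: cyc_arc_def del: upt_Suc)

lemma nth_cyc_arc:
  "k \<le> (j + length xs - i) mod length xs \<Longrightarrow> cyc_arc xs i j ! k = xs ! ((i + k) mod length xs)"
  by (simp add: cyc_arc_def del: upt_Suc)

lemma hd_cyc_arc: "i < length xs \<Longrightarrow> hd (cyc_arc xs i j) = xs ! i"
  by (simp add: hd_conv_nth nth_cyc_arc length_cyc_arc flip: length_greater_0_conv)

lemma last_cyc_arc:
  assumes "i < length xs" "j < length xs"
  shows "last (cyc_arc xs i j) = xs ! j"
proof -
  have "(i + (j + length xs - i) mod length xs) mod length xs = (i + (j + length xs - i)) mod length xs"
    by (rule mod_add_right_eq)
  then have "(i + (j + length xs - i) mod length xs) mod length xs = j"
    using assms by simp
  moreover have "cyc_arc xs i j \<noteq> []"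
    by (simp flip: length_greater_0_conv add: length_cyc_arc)
  ultimately show ?thesis
    by (simp add: last_conv_nth length_cyc_arc nth_cyc_arc)
qed

text \<open>An arc takes at most \<open>length xs\<close> consecutive indices modulo
  \<open>length xs\<close>, so no vertex repeats even when it wraps past the end of the
  list.\<close>

lemma gpath_cyc_arc:
  assumes "gcycle V E xs"
  shows "gpath V E (cyc_arc xs i j)"
proof -
  let ?n = "length xs" and ?m = "(j + length xs - i) mod length xs"
  have n: "?n > 0"
    using assms by (simp add: gcycle_def flip: length_greater_0_conv)
  then have m: "?m < ?n"
    by (rule mod_less_divisor)
  have "k = l" if le: "k \<le> ?m" "l \<le> ?m" and eq: "(i + k) mod ?n = (i + l) mod ?n" for k l
  proof -
    \<comment> \<open>Congruence as an equality of naturals after adding multiples of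
      \<open>?n\<close>; in this form \<open>i\<close> cancels.\<close>
    obtain q r where "i + k + ?n * q = i + l + ?n * r"
      using eq nat_mod_eq_iff by blast
    then have "k + ?n * q = l + ?n * r"
      by simp
    then have "k mod ?n = l mod ?n"
      by (metis mod_mult_self2)
    then show ?thesis
      using le m by simp
  qed
  then have "distinct (cyc_arc xs i j)"
    using assms n
    by (auto simp: distinct_conv_nth length_cyc_arc nth_cyc_arc gcycle_def nth_eq_iff_index_eq less_Suc_eq_le)
  moreover have "set (cyc_arc xs i j) \<subseteq> V"
    using assms n by (force simp: cyc_arc_def gcycle_def)
  moreover have "{cyc_arc xs i j ! k, cyc_arc xs i j ! Suc k} \<in> E"
    if "Suc k < length (cyc_arc xs i j)" for k
  proof -
    have "{xs ! ((i + k) mod ?n), xs ! (Suc ((i + k) mod ?n) mod ?n)} \<in> E"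
      using assms n by (simp add: gcycle_def)
    then show ?thesis
      using that by (simp add: length_cyc_arc nth_cyc_arc mod_Suc_eq)
  qed
  ultimately show ?thesis
    by (simp add: gpath_def flip: length_greater_0_conv) (simp add: length_cyc_arc)
qed

section \<open>Distances on geodetic cycles and the bound on their length\<close>

text \<open>The geodesic arc may run from \<open>xs ! j\<close> to \<open>xs ! i\<close>, so
  \<open>ys\<close> is compared with it after reversal.\<close>

lemma geodetic_cycle_path_length:
  assumes C: "geodetic_cycle V E xs" and ij: "i < length xs" "j < length xs"
    and ys: "gpath V E ys" "hd ys = xs ! i" "last ys = xs ! j"
  shows "min (length (cyc_arc xs i j)) (length (cyc_arc xs j i)) \<le> length ys"
proof -
  have "gpath V E (rev ys)" "hd (rev ys) = xs ! j" "last (rev ys) = xs ! i"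
    using ys by (auto simp: gpath_rev hd_rev last_rev)
  moreover have "geodesic V E (cyc_arc xs i j) \<or> geodesic V E (cyc_arc xs j i)"
    using C ij by (simp add: geodetic_cycle_def)
  ultimately show ?thesis
    using ys ij unfolding geodesic_def
    by (metis hd_cyc_arc last_cyc_arc length_rev min.coboundedI1 min.coboundedI2)
qed

text \<open>\<open>geodetic_cycle\<close> leaves open which of the two arcs is geodesic. Every
  competing path is at least as long as the shorter arc, which settles the choice.\<close>

lemma geodesic_short_cyc_arc:
  assumes C: "geodetic_cycle V E xs" and ij: "i < length xs" "j < length xs"
    and le: "length (cyc_arc xs i j) \<le> length (cyc_arc xs j i)"
  shows "geodesic V E (cyc_arc xs i j)"
  using geodetic_cycle_path_length[OF C ij] gpath_cyc_arc[of V E xs i j] C ij le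
  by (auto simp: geodesic_def geodetic_cycle_def hd_cyc_arc last_cyc_arc min_absorb1)

lemma geodetic_cycle_gdist_ge:
  assumes C: "geodetic_cycle V E xs" and ij: "i < length xs" "j < length xs"
  shows "min (length (cyc_arc xs i j)) (length (cyc_arc xs j i)) \<le> Suc (gdist V E (xs ! i) (xs ! j))"
proof -
  let ?P = "\<lambda>n. \<exists>ys. gpath V E ys \<and> hd ys = xs ! i \<and> last ys = xs ! j \<and> length ys = Suc n"
  \<comment> \<open>An arc witnesses that the \<open>LEAST\<close> in \<open>gdist\<close> is
    attained. The \<open>Suc\<close> in the claim arises because lists count vertices and
    \<open>gdist\<close> counts edges.\<close>
  have "?P ((j + length xs - i) mod length xs)"
    using C ij gpath_cyc_arc[of V E xs i j] length_cyc_arc[of xs i j]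
    by (metis geodetic_cycle_def hd_cyc_arc last_cyc_arc)
  then have "?P (gdist V E (xs ! i) (xs ! j))"
    unfolding gdist_def by (rule LeastI)
  then show ?thesis
    using geodetic_cycle_path_length[OF C ij] by metis
qed

lemma length_cyc_arc_le:
  "\<lbrakk>i \<le> j; j < length xs\<rbrakk> \<Longrightarrow> length (cyc_arc xs i j) = Suc (j - i)"
  using mod_add_self2[of "j - i" "length xs"] by (simp add: length_cyc_arc)

lemma length_cyc_arc_gt:
  "\<lbrakk>j < i; i < length xs\<rbrakk> \<Longrightarrow> length (cyc_arc xs i j) = Suc (j + length xs - i)"
  by (simp add: length_cyc_arc)

lemma in_cyc_arcE:
  assumes "w \<in> set (cyc_arc xs i j)" "i < length xs"
  obtains k where "k \<le> (j + length xs - i) mod length xs" "w = xs ! ((i + k) mod length xs)"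
  using assms by (auto simp: cyc_arc_def less_Suc_eq_le simp del: upt_Suc)

text \<open>The midpoint of a side has distance at least \<open>m\<close> from the other two sides,
  so \<open>m\<close> is at most the floor of \<delta>. The additive constant absorbs the rounding,
  since \<open>n \<le> 3 * k + 2 \<le> 6 * m + 5\<close>.\<close>

lemma geodetic_cycle_length_le:
  assumes C: "geodetic_cycle V E xs"
    and hyp: "\<And>P Q R. \<lbrakk>geodesic V E P; geodesic V E Q; geodesic V E R;
        last P = hd Q; last Q = hd R; last R = hd P\<rbrakk> \<Longrightarrow> near_side V E \<delta> P Q R"
  shows "length xs \<le> 6 * nat \<lfloor>\<delta>\<rfloor> + 8"
proof (cases "length xs < 6")
  case False
  define n where "n = length xs"
  \<comment> \<open>The triangle has corners at the indices 0, \<open>k\<close> and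
    \<open>2 * k\<close>; \<open>m\<close> is the midpoint of its first side.\<close>
  define k where "k = n div 3"
  define m where "m = k div 2"
  have k: "2 \<le> k" "3 * k \<le> n" "n \<le> 3 * k + 2" and m: "2 * m \<le> k" "k \<le> 2 * m + 1"
    using False unfolding k_def m_def n_def by linarith+
  note len = length_cyc_arc_le length_cyc_arc_gt n_def[symmetric]
  have "geodesic V E (cyc_arc xs 0 k)"
    by (rule geodesic_short_cyc_arc[OF C]) (use k in \<open>simp_all add: len\<close>)
  moreover have "geodesic V E (cyc_arc xs k (2 * k))"
    by (rule geodesic_short_cyc_arc[OF C]) (use k in \<open>simp_all add: len\<close>)
  \<comment> \<open>The last side takes the remainder of the division by 3: it has
    \<open>n - 2 * k \<le> k + 2\<close> edges, and \<open>2 \<le> k\<close> makes this at most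
    \<open>2 * k\<close>, the length of the complementary arc.\<close>
  moreover have "geodesic V E (cyc_arc xs (2 * k) 0)"
    by (rule geodesic_short_cyc_arc[OF C]) (use k in \<open>simp_all add: len\<close>)
  ultimately have near: "near_side V E \<delta> (cyc_arc xs 0 k) (cyc_arc xs k (2 * k)) (cyc_arc xs (2 * k) 0)"
    by (rule hyp) (use k in \<open>simp_all add: hd_cyc_arc last_cyc_arc n_def[symmetric]\<close>)
  have "cyc_arc xs 0 k ! m = xs ! m"
    using k m by (simp add: nth_cyc_arc n_def[symmetric])
  moreover have "m < length (cyc_arc xs 0 k)"
    using k m by (simp add: len)
  ultimately have "xs ! m \<in> set (cyc_arc xs 0 k)"
    by (metis nth_mem)
  then obtain w where w: "w \<in> set (cyc_arc xs k (2 * k)) \<union> set (cyc_arc xs (2 * k) 0)"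
    and dist: "real (gdist V E (xs ! m) w) \<le> \<delta>"
    using near unfolding near_side_def by blast
  \<comment> \<open>Both other sides together occupy the indices from \<open>k\<close> to
    \<open>n\<close>, where \<open>n\<close> stands for the corner at index 0 reached again.\<close>
  obtain j where j: "k \<le> j" "j \<le> n" "w = xs ! (j mod n)"
    using w
  proof
    assume "w \<in> set (cyc_arc xs k (2 * k))"
    then obtain l where "l \<le> (2 * k + n - k) mod n" "w = xs ! ((k + l) mod n)"
      unfolding n_def by (rule in_cyc_arcE) (use k n_def in auto)
    moreover have "(2 * k + n - k) mod n = k"
      using k by simp
    ultimately show ?thesis
      using that[of "k + l"] k by simp
  next
    assume "w \<in> set (cyc_arc xs (2 * k) 0)"
    then obtain l where "l \<le> (0 + n - 2 * k) mod n" "w = xs ! ((2 * k + l) mod n)"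
      unfolding n_def by (rule in_cyc_arcE) (use k n_def in auto)
    then show ?thesis
      using that[of "2 * k + l"] k by simp
  qed
  \<comment> \<open>The two arcs between the indices \<open>m\<close> and \<open>j\<close> have
    \<open>j - m \<ge> k - m \<ge> m\<close> and \<open>n - j + m \<ge> m\<close> edges.\<close>
  have "m \<le> gdist V E (xs ! m) w"
  proof (cases "j = n")
    case True
    then show ?thesis
      using geodetic_cycle_gdist_ge[OF C, of m 0] j k m
      by (cases "m = 0") (auto simp: len)
  next
    case False
    then show ?thesis
      using geodetic_cycle_gdist_ge[OF C, of m j] j k m
      by (cases "m = j") (auto simp: len)
  qed
  then have "m \<le> nat \<lfloor>\<delta>\<rfloor>"
    using dist by (simp add: le_nat_floor)
  then show ?thesis
    using k m unfolding n_def by linarith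
qed simp

section \<open>Vertices and faces inside a cycle of a plane graph\<close>

lemma cycle_edges_subset: "gcycle V E C \<Longrightarrow> cycle_edges C \<subseteq> E"
  by (auto simp: gcycle_def cycle_edges_def)

lemma Union_cycle_edges_subset: "\<Union> (cycle_edges C) \<subseteq> set C"
proof -
  have "C ! (Suc i mod length C) \<in> set C" if "i < length C" for i
    using that by (intro nth_mem mod_less_divisor) linarith
  then show ?thesis
    by (auto simp: cycle_edges_def)
qed

text \<open>Compactness will make the inside of the cycle bounded and its outside open.\<close>

lemma compact_cycle_image:
  assumes "plane_graph V E p a" "gcycle V E C"
  shows "compact (cycle_image a C)"
proof -
  have "finite (cycle_edges C)"
    by (simp add: cycle_edges_def)
  moreover have "compact (path_image (a e))" if "e \<in> cycle_edges C" for e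
    using that assms cycle_edges_subset[OF assms(2)]
    by (auto simp: plane_graph_def intro!: compact_path_image arc_imp_path)
  ultimately show ?thesis
    by (auto simp: cycle_image_def)
qed

lemma vertex_on_cycle_image:
  assumes "plane_graph V E p a" "gcycle V E C" "v \<in> V" "p v \<in> cycle_image a C"
  shows "v \<in> set C"
proof -
  obtain e where "e \<in> cycle_edges C" "p v \<in> path_image (a e)"
    using assms(4) by (auto simp: cycle_image_def)
  moreover have "e \<in> E"
    using calculation(1) cycle_edges_subset[OF assms(2)] by blast
  ultimately have "v \<in> e"
    using assms(1,3) by (auto simp: plane_graph_def)
  then show ?thesis
    using Union_cycle_edges_subset[of C] \<open>e \<in> cycle_edges C\<close> by auto
qed

lemma vertex_in_edge_image:
  assumes "plane_graph V E p a" "e \<in> E" "v \<in> e"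
  shows "p v \<in> path_image (a e)"
proof -
  have "p v \<in> {pathstart (a e), pathfinish (a e)}"
    using assms by (auto simp: plane_graph_def)
  then show ?thesis
    by auto
qed

text \<open>An edge leaving the inside must meet the cycle. It can do so only at one of its ends,
  and the inner end is off the cycle, so the outer end is on it.\<close>

lemma vboundary_inside_cycle:
  assumes G: "plane_graph V E p a" and C: "gcycle V E C"
  shows "vboundary V E {v \<in> V. p v \<in> inside (cycle_image a C)} \<subseteq> set C"
proof
  let ?K = "cycle_image a C"
  fix v assume "v \<in> vboundary V E {v \<in> V. p v \<in> inside ?K}"
  then obtain u where v: "v \<in> V" "p v \<notin> inside ?K" and u: "u \<in> V" "p u \<in> inside ?K"
    and e: "{u, v} \<in> E"
    by (auto simp: vboundary_def)
  let ?A = "path_image (a {u, v})"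
  have uA: "p u \<in> ?A" and vA: "p v \<in> ?A"
    using vertex_in_edge_image[OF G e] by auto
  have "connected ?A"
    using G e by (auto simp: plane_graph_def intro!: connected_path_image arc_imp_path)
  have uK: "p u \<notin> ?K"
    using u inside_no_overlap by blast
  have "p v \<in> ?K"
  proof (rule ccontr)
    assume vK: "p v \<notin> ?K"
    have "?A \<inter> path_image (a e') = {}" if e': "e' \<in> cycle_edges C" for e'
    proof -
      have "path_image (a e') \<subseteq> ?K"
        using e' by (auto simp: cycle_image_def)
      moreover have "?A \<inter> path_image (a e') \<subseteq> p ` {u, v}"
      proof -
        \<comment> \<open>The edge is not itself an edge of the cycle, because its end
          \<open>p u\<close> is off \<open>?K\<close>.\<close>
        have "{u, v} \<noteq> e'"
          using uA uK calculation by auto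
        moreover have "e' \<in> E"
          using e' cycle_edges_subset[OF C] by blast
        ultimately show ?thesis
          using G e by (fastforce simp: plane_graph_def)
      qed
      ultimately show ?thesis
        using uK vK by auto
    qed
    then have "?A \<inter> ?K = {}"
      by (auto simp: cycle_image_def)
    \<comment> \<open>The connected arc avoids \<open>?K\<close>, so it keeps both ends in one
      component of the complement.\<close>
    then have "connected_component (- ?K) (p u) (p v)"
      using \<open>connected ?A\<close> uA vA unfolding connected_component_def by blast
    then have "p v \<in> inside ?K"
      using u(2) inside_same_component by blast
    with v show False
      by blast
  qed
  with G C v show "v \<in> set C"
    by (blast intro: vertex_on_cycle_image)
qed

text \<open>Infinitely many vertices in a compact set would accumulate there.\<close>

lemma finite_vertices_in_bounded:
  assumes "inj_on p V" "\<forall>z. \<not> z islimpt (p ` V)" "bounded (B :: complex set)"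
  shows "finite {v \<in> V. p v \<in> B}"
proof -
  have "finite (closure B \<inter> p ` V)"
    using assms(2,3) by (intro finite_not_islimpt_in_compact) (auto simp: compact_closure)
  then have "finite (p ` {v \<in> V. p v \<in> B})"
    by (rule finite_subset[rotated]) (use closure_subset in auto)
  then show ?thesis
    by (rule finite_imageD) (use assms(1) in \<open>auto simp: inj_on_def\<close>)
qed

text \<open>The cycle together with its inside is the complement of the open outside, hence closed.
  It therefore contains the closure of \<open>F\<close>, and with it both ends of every edge of the
  face.\<close>

lemma face_edges_inside_cycle:
  assumes G: "plane_graph V E p a" and C: "gcycle V E C" and F: "inside_cycle a C F"
  shows "face_edges E a F \<subseteq> Pow ({v \<in> V. p v \<in> inside (cycle_image a C)} \<union> set C)"
proof -
  let ?K = "cycle_image a C"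
  have "closed (- outside ?K)"
    using compact_cycle_image[OF G C] by (simp add: open_outside compact_imp_closed closed_Compl)
  moreover have "?K \<union> inside ?K = - outside ?K"
    using inside_Un_outside[of ?K] inside_Int_outside[of ?K] outside_no_overlap[of ?K] by blast
  ultimately have cl: "closure F \<subseteq> ?K \<union> inside ?K"
    using F by (simp add: inside_cycle_def closure_minimal)
  show ?thesis
  proof (intro subsetI PowI)
    fix e v assume "e \<in> face_edges E a F" "v \<in> e"
    then have e: "e \<in> E" and "path_image (a e) \<subseteq> closure F"
      by (auto simp: face_edges_def)
    then have "p v \<in> ?K \<union> inside ?K"
      using vertex_in_edge_image[OF G e \<open>v \<in> e\<close>] cl by blast
    moreover have "v \<in> V"
      using G e \<open>v \<in> e\<close> by (fastforce simp: plane_graph_def)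
    ultimately show "v \<in> {v \<in> V. p v \<in> inside ?K} \<union> set C"
      using vertex_on_cycle_image[OF G C] by blast
  qed
qed

theorem corollary3p2:
  fixes V :: "'v set" and E :: "'v set set"
    and p :: "'v \<Rightarrow> complex" and a :: "'v set \<Rightarrow> real \<Rightarrow> complex"
  assumes "plane_graph V E p a"
    and "\<forall>z. \<not> z islimpt (p ` V)"
    and "bounded_degree V E"
    and "hyperbolic V E"
    and "weakly_nonamenable V E"
    and "\<forall>F \<in> faces V E p a. \<exists>C. geodetic_cycle V E C \<and> inside_cycle a C F"
  shows "codegree V E p a < \<infinity>"
proof -
  obtain \<delta> :: real where hyp: "\<And>P Q R. \<lbrakk>geodesic V E P; geodesic V E Q; geodesic V E R;
      last P = hd Q; last Q = hd R; last R = hd P\<rbrakk> \<Longrightarrow> near_side V E \<delta> P Q R"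
    using assms(4) unfolding hyperbolic_def by blast
  obtain f :: "nat \<Rightarrow> nat" where f: "mono f"
    "\<And>S. \<lbrakk>S \<subseteq> V; finite S; S \<noteq> {}\<rbrakk> \<Longrightarrow> card S \<le> f (card (vboundary V E S))"
    using assms(5) unfolding weakly_nonamenable_def by blast
  define L where "L = 6 * nat \<lfloor>\<delta>\<rfloor> + 8"
  \<comment> \<open>Edges are counted crudely as subsets of the at most \<open>f L + L\<close>
    vertices inside or on the cycle. The bound depends on \<open>L\<close> and \<open>f\<close>
    only, not on \<open>F\<close>.\<close>
  have bound: "card (face_edges E a F) \<le> 2 ^ (f L + L)" if F: "F \<in> faces V E p a" for F
  proof -
    obtain C where C: "geodetic_cycle V E C" "inside_cycle a C F"
      using assms(6) F by blast
    then have gC: "gcycle V E C"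
      by (simp add: geodetic_cycle_def)
    have "length C \<le> L"
      unfolding L_def using C(1) hyp by (rule geodetic_cycle_length_le)
    then have cardC: "card (set C) \<le> L"
      using card_length le_trans by blast
    define S where "S = {v \<in> V. p v \<in> inside (cycle_image a C)}"
    have finS: "finite S"
      unfolding S_def using assms(1,2) compact_cycle_image[OF assms(1) gC]
      by (intro finite_vertices_in_bounded)
        (auto simp: plane_graph_def bounded_inside compact_imp_bounded)
    have "card (vboundary V E S) \<le> L"
      using card_mono[OF _ vboundary_inside_cycle[OF assms(1) gC]] cardC unfolding S_def by simp
    then have "f (card (vboundary V E S)) \<le> f L"
      by (rule monoD[OF f(1)])
    moreover have "S \<subseteq> V"
      by (auto simp: S_def)
    \<comment> \<open>Weak non-amenability speaks of non-empty sets, so a cycle with no vertex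
      inside is a separate case.\<close>
    ultimately have "card S \<le> f L"
      using f(2)[of S] finS by (cases "S = {}") auto
    then have "card (S \<union> set C) \<le> f L + L"
      using cardC card_Un_le[of S "set C"] by simp
    moreover have "card (face_edges E a F) \<le> card (Pow (S \<union> set C))"
      using face_edges_inside_cycle[OF assms(1) gC C(2)] finS unfolding S_def
      by (intro card_mono) auto
    ultimately show ?thesis
      using finS by (simp add: card_Pow) (meson le_trans one_le_numeral power_increasing)
  qed
  have "codegree V E p a \<le> enat (2 ^ (f L + L))"
    unfolding codegree_def using bound by (auto intro!: SUP_least)
  then show ?thesis
    using enat_ord_code(4) order_le_less_trans by blast
qed

end
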